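(* Let $(b_n)_{n\ge1}$ be a sequence of positive integers with $b_n\to\infty$ and $b_n/n\to b\in[0,1]$ as $n\to\infty$. Let $\{x_j\}_{j\in\mathbb{Z}\setminus\{0\}}$ be independent real random variables such that $\mathbb{E}[x_j]=0$, $\mathbb{E}[x_j^2]=1$ and $\mathbb{E}[x_j^4]=\kappa$ for all $j$ (with $\kappa$ not depending on $j$), and $\sup_j\mathbb{E}[|x_j|^k]=\alpha_k<\infty$ for every integer $k\ge3$; put $x_0\equiv0$. Let $H_n$ be the $n\times n$ band Hankel matrix $H_n=P_nT_n$ with $T_n=(x_{i-j}\,\delta_{|i-j|\le b_n})_{i,j=1}^n$, let $A_n=H_n/\sqrt{b_n}$, and let $$w_p=\frac{\sqrt{b_n}}{n}\Big\{\operatorname{Tr}(A_n^p)-\mathbb{E}[\operatorname{Tr}(A_n^p)]\Big\}.$$ Then for every odd integer $p\ge1$, $w_p\to0$ in distribution as $n\to\infty$.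
   Context: $P_n=(\delta_{i-1,n-j})_{i,j=1}^n$ is the backward identity permutation matrix, and $\delta_{|i-j|\le b_n}$ equals $1$ if $|i-j|\le b_n$ and $0$ otherwise. *)

theory Defs
  imports "HOL-Probability.Probability" "Jordan_Normal_Form.Matrix"
begin

text \<open>Matrices are indexed from 0, so entry \<open>(i, j)\<close> below is entry \<open>(i + 1, j + 1)\<close> in
  the usual 1-based numbering.  Differences \<open>i - j\<close> are unaffected by the shift.\<close>

definition backward_identity :: "nat \<Rightarrow> real mat" where
  "backward_identity n = Matrix.mat n n (\<lambda>(i, j). if Suc i - 1 = n - Suc j then 1 else 0)"

definition band_toeplitz :: "nat \<Rightarrow> nat \<Rightarrow> (int \<Rightarrow> real) \<Rightarrow> real mat" where
  "band_toeplitz n b x =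
     Matrix.mat n n (\<lambda>(i, j). if \<bar>int i - int j\<bar> \<le> int b then x (int i - int j) else 0)"

definition band_hankel :: "nat \<Rightarrow> nat \<Rightarrow> (int \<Rightarrow> real) \<Rightarrow> real mat" where
  "band_hankel n b x = backward_identity n * band_toeplitz n b x"

definition scaled_band_hankel :: "nat \<Rightarrow> nat \<Rightarrow> (int \<Rightarrow> real) \<Rightarrow> real mat" where
  "scaled_band_hankel n b x = (1 / sqrt (real b)) \<cdot>\<^sub>m band_hankel n b x"

definition mat_trace :: "real mat \<Rightarrow> real" where
  "mat_trace A = (\<Sum>i<dim_row A. A $$ (i, i))"

definition trace_fluctuation ::
  "'a measure \<Rightarrow> (int \<Rightarrow> 'a \<Rightarrow> real) \<Rightarrow> nat \<Rightarrow> nat \<Rightarrow> nat \<Rightarrow> 'a \<Rightarrow> real" where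
  "trace_fluctuation M x n b p \<omega> =
     sqrt (real b) / real n *
       (mat_trace (scaled_band_hankel n b (\<lambda>j. x j \<omega>) ^\<^sub>m p) -
        (\<integral>\<omega>'. mat_trace (scaled_band_hankel n b (\<lambda>j. x j \<omega>') ^\<^sub>m p) \<partial>M))"

end

theory Submission
  imports Defs
begin

text \<open>
  Expand the trace as a sum over index tuples \<open>i\<^sub>0, \<dots>, i\<^sub>p = i\<^sub>0\<close> of products of the entries
  \<open>x (c\<^sub>k)\<close> with \<open>c\<^sub>k = n - 1 - i\<^sub>k - i\<^sub>k\<^sub>+\<^sub>1\<close>.  For odd \<open>p\<close> the alternating sum of the \<open>c\<^sub>k\<close> equals
  \<open>n - 1 - 2 i\<^sub>0\<close>, so the tuple of the \<open>c\<^sub>k\<close> determines all the indices and the trace has no free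
  summation over the starting index.  In the second moment of the trace, a \<open>2p\<close>-tuple of values in
  \<open>[-b\<^sub>n, b\<^sub>n]\<close> contributes only if each value occurs at least twice, hence at most \<open>p\<close> distinct
  values occur and there are \<open>O(b\<^sub>n ^ p)\<close> such tuples.  After normalisation the variance is
  \<open>O(b\<^sub>n / n\<^sup>2)\<close>, which tends to 0.
\<close>

section \<open>Traces of powers of band Hankel matrices\<close>

abbreviation words :: "nat \<Rightarrow> nat \<Rightarrow> int list set" where
  "words b k \<equiv> {cs. set cs \<subseteq> {- int b..int b} \<and> length cs = k}"

text \<open>The walk is read backwards from its end point \<open>j\<close>, matching the recursion
  \<open>A ^\<^sub>m Suc k = A ^\<^sub>m k * A\<close>.\<close>

fun hankel_path :: "nat \<Rightarrow> nat \<Rightarrow> int list \<Rightarrow> nat \<Rightarrow> bool" where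
  "hankel_path n i [] j \<longleftrightarrow> i = j"
| "hankel_path n i (c # cs) j \<longleftrightarrow>
     (\<exists>k<n. int k = int n - 1 - int j - c \<and> hankel_path n i cs k)"

lemma band_hankel_carrier: "scaled_band_hankel n b x \<in> carrier_mat n n"
  unfolding scaled_band_hankel_def band_hankel_def backward_identity_def band_toeplitz_def
  by (intro smult_carrier_mat mult_carrier_mat[of _ n n]) simp_all

text \<open>Left multiplication by the backward identity reverses the rows of the Toeplitz matrix,
  so the entry depends on \<open>i + j\<close> only, through the letter
  \<open>n - 1 - i - j\<close>.\<close>

lemma band_hankel_index:
  assumes "i < n" "j < n"
  shows "band_hankel n b x $$ (i, j) =
    (if \<bar>int n - 1 - int i - int j\<bar> \<le> int b then x (int n - 1 - int i - int j) else 0)"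
proof -
  have "band_hankel n b x $$ (i, j) =
      (\<Sum>k = 0..<n. (if i = n - Suc k then 1 else 0) *
        (if \<bar>int k - int j\<bar> \<le> int b then x (int k - int j) else 0))"
    using assms
    by (simp add: band_hankel_def backward_identity_def band_toeplitz_def scalar_prod_def)
  \<comment> \<open>The row reversal is an involution on the indices below \<open>n\<close>, where
    the truncated subtraction is exact; this solves its condition for \<open>k\<close>.\<close>
  also have "\<dots> = (\<Sum>k = 0..<n. if k = n - Suc i then
      (if \<bar>int k - int j\<bar> \<le> int b then x (int k - int j) else 0) else 0)"
    using assms by (intro sum.cong) auto
  also have "\<dots> = (if \<bar>int (n - Suc i) - int j\<bar> \<le> int b then x (int (n - Suc i) - int j) else 0)"
    using assms by (subst sum.delta) auto
  also have "int (n - Suc i) = int n - 1 - int i"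
    using assms by auto
  finally show ?thesis .
qed

text \<open>At most one letter \<open>c\<close> contributes, and none if the entry lies outside the
  band. Writing the entry as a sum over letters, with the condition of one
  \<open>hankel_path\<close> step, turns matrix products into sums over words.\<close>

lemma scaled_band_hankel_index:
  assumes "i < n" "j < n"
  shows "scaled_band_hankel n b x $$ (i, j) =
    1 / sqrt (real b) * (\<Sum>c\<in>{- int b..int b}. of_bool (int i = int n - 1 - int j - c) * x c)"
proof -
  have "(\<Sum>c\<in>{- int b..int b}. of_bool (int i = int n - 1 - int j - c) * x c) =
      (\<Sum>c\<in>{- int b..int b}. if c = int n - 1 - int i - int j then x c else 0)"
    by (intro sum.cong) auto
  also have "\<dots> = band_hankel n b x $$ (i, j)"
    using assms by (subst sum.delta) (auto simp: band_hankel_index)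
  finally show ?thesis
    using assms
    by (simp add: scaled_band_hankel_def band_hankel_def backward_identity_def band_toeplitz_def)
qed

lemma sum_words_Suc:
  fixes f :: "int list \<Rightarrow> real"
  shows "sum f (words b (Suc k)) = (\<Sum>c\<in>{- int b..int b}. \<Sum>cs\<in>words b k. f (c # cs))"
proof -
  have "sum f (words b (Suc k)) = (\<Sum>(cs, c)\<in>words b k \<times> {- int b..int b}. f (c # cs))"
    unfolding lists_length_Suc_eq by (subst sum.reindex) (auto simp: inj_on_def split_def)
  also have "\<dots> = (\<Sum>cs\<in>words b k. \<Sum>c\<in>{- int b..int b}. f (c # cs))"
    by (simp add: sum.cartesian_product)
  finally show ?thesis
    by (subst sum.swap) simp
qed

lemma scaled_band_hankel_pow_index:
  assumes "i < n" "j < n"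
  shows "(scaled_band_hankel n b x ^\<^sub>m k) $$ (i, j) =
    (1 / sqrt (real b)) ^ k *
      (\<Sum>cs\<in>words b k. of_bool (hankel_path n i cs j) * prod_list (map x cs))"
  using assms
proof (induction k arbitrary: j)
  case 0
  have "words b 0 = {[]}"
    by auto
  moreover have "dim_row (scaled_band_hankel n b x) = n"
    using band_hankel_carrier by blast
  ultimately show ?case
    using 0 by simp
next
  case (Suc k)
  let ?A = "scaled_band_hankel n b x" and ?s = "1 / sqrt (real b)"
  let ?B = "{- int b..int b}"
  have dims: "dim_row ?A = n" "dim_col ?A = n"
    using band_hankel_carrier by blast+
  \<comment> \<open>Given \<open>j\<close>, the letter \<open>c\<close> fixes the intermediate index
    as \<open>n - 1 - j - c\<close>. The sum over \<open>l\<close> therefore has one term if this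
    value is a valid index and is empty otherwise, just as in the recursion of
    \<open>hankel_path\<close>.\<close>
  have path_step: "(\<Sum>l = 0..<n. of_bool (hankel_path n i cs l) *
      of_bool (int l = int n - 1 - int j - c)) = (of_bool (hankel_path n i (c # cs) j) :: real)"
    for c cs
  proof (cases "0 \<le> int n - 1 - int j - c \<and> int n - 1 - int j - c < int n")
    case True
    define l0 where "l0 = nat (int n - 1 - int j - c)"
    have l0: "int l0 = int n - 1 - int j - c" "l0 < n"
      using True by (auto simp: l0_def)
    have "(\<Sum>l = 0..<n. of_bool (hankel_path n i cs l) *
        of_bool (int l = int n - 1 - int j - c)) =
        (\<Sum>l = 0..<n. if l = l0 then of_bool (hankel_path n i cs l) else (0::real))"
      using l0 by (intro sum.cong) auto
    also have "\<dots> = of_bool (hankel_path n i cs l0)"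
      using l0 by simp
    also have "hankel_path n i cs l0 \<longleftrightarrow> hankel_path n i (c # cs) j"
      using l0 by (metis hankel_path.simps(2) of_nat_eq_iff)
    finally show ?thesis .
  next
    case False
    then have "int l \<noteq> int n - 1 - int j - c" if "l < n" for l
      using that by auto
    then show ?thesis
      by auto
  qed
  have "(?A ^\<^sub>m Suc k) $$ (i, j) = (\<Sum>l = 0..<n. (?A ^\<^sub>m k) $$ (i, l) * ?A $$ (l, j))"
    using Suc.prems dims by (simp add: scalar_prod_def)
  also have "\<dots> = (\<Sum>l = 0..<n.
      (?s ^ k * (\<Sum>cs\<in>words b k. of_bool (hankel_path n i cs l) * prod_list (map x cs))) *
      (?s * (\<Sum>c\<in>?B. of_bool (int l = int n - 1 - int j - c) * x c)))"
    using Suc by (intro sum.cong refl arg_cong2[where f = "(*)"] scaled_band_hankel_index) auto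
  also have "\<dots> = ?s ^ Suc k * (\<Sum>l = 0..<n.
      (\<Sum>cs\<in>words b k. of_bool (hankel_path n i cs l) * prod_list (map x cs)) *
      (\<Sum>c\<in>?B. of_bool (int l = int n - 1 - int j - c) * x c))"
    by (simp add: sum_distrib_left mult_ac)
  also have "(\<Sum>l = 0..<n.
      (\<Sum>cs\<in>words b k. of_bool (hankel_path n i cs l) * prod_list (map x cs)) *
      (\<Sum>c\<in>?B. of_bool (int l = int n - 1 - int j - c) * x c)) =
      (\<Sum>l = 0..<n. \<Sum>c\<in>?B. \<Sum>cs\<in>words b k. of_bool (hankel_path n i cs l) *
        of_bool (int l = int n - 1 - int j - c) * prod_list (map x (c # cs)))"
    \<comment> \<open>The factors are exchanged first so that the new head letter \<open>c\<close>
      becomes the outer summation, as in \<open>sum_words_Suc\<close>.\<close>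
    by (intro sum.cong refl, subst mult.commute, unfold sum_product)
       (intro sum.cong refl, simp)
  also have "\<dots> = (\<Sum>c\<in>?B. \<Sum>cs\<in>words b k. \<Sum>l = 0..<n. of_bool (hankel_path n i cs l) *
        of_bool (int l = int n - 1 - int j - c) * prod_list (map x (c # cs)))"
    by (subst sum.swap, intro sum.cong refl, subst sum.swap) (rule refl)
  also have "\<dots> = (\<Sum>c\<in>?B. \<Sum>cs\<in>words b k.
      of_bool (hankel_path n i (c # cs) j) * prod_list (map x (c # cs)))"
    by (simp only: sum_distrib_right [symmetric] path_step)
  also have "\<dots> = (\<Sum>cs\<in>words b (Suc k).
      of_bool (hankel_path n i cs j) * prod_list (map x cs))"
    by (rule sum_words_Suc [symmetric])
  finally show ?case .
qed

text \<open>This is the coefficient of the word \<open>cs\<close> in the expansion of the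
  unnormalised trace.\<close>

definition closed_paths :: "nat \<Rightarrow> int list \<Rightarrow> nat" where
  "closed_paths n cs = card {i. i < n \<and> hankel_path n i cs i}"

lemma mat_trace_scaled_band_hankel_pow:
  "mat_trace (scaled_band_hankel n b x ^\<^sub>m p) =
    (1 / sqrt (real b)) ^ p * (\<Sum>cs\<in>words b p. real (closed_paths n cs) * prod_list (map x cs))"
proof -
  have count: "real (closed_paths n cs) = (\<Sum>i<n. of_bool (hankel_path n i cs i))" for cs
  proof -
    have "(\<Sum>i<n. of_bool (hankel_path n i cs i) :: real) =
        of_nat (card ({..<n} \<inter> {i. hankel_path n i cs i}))"
      by (subst sum_of_bool_eq) auto
    also have "{..<n} \<inter> {i. hankel_path n i cs i} = {i. i < n \<and> hankel_path n i cs i}"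
      by auto
    finally show ?thesis
      by (simp add: closed_paths_def)
  qed
  have "dim_row (scaled_band_hankel n b x) = n"
    using band_hankel_carrier by blast
  then have "mat_trace (scaled_band_hankel n b x ^\<^sub>m p) = (\<Sum>i<n. (1 / sqrt (real b)) ^ p *
      (\<Sum>cs\<in>words b p. of_bool (hankel_path n i cs i) * prod_list (map x cs)))"
    unfolding mat_trace_def
    by (simp add: scaled_band_hankel_pow_index del: pow_mat.simps)
  also have "\<dots> = (1 / sqrt (real b)) ^ p *
      (\<Sum>cs\<in>words b p. \<Sum>i<n. of_bool (hankel_path n i cs i) * prod_list (map x cs))"
    unfolding sum_distrib_left [symmetric] by (subst sum.swap) (rule refl)
  finally show ?thesis
    by (simp only: count sum_distrib_right)
qed

text \<open>Two walks along the same word take steps of the form \<open>j\<close> to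
  \<open>n - 1 - j - c\<close> with the same \<open>c\<close>, so every step negates their
  difference.\<close>

lemma hankel_path_diff:
  assumes "hankel_path n i cs j" "hankel_path n i' cs j'"
  shows "int i - int i' = (- 1) ^ length cs * (int j - int j')"
  using assms
proof (induction cs arbitrary: j j')
  case (Cons c cs)
  from Cons.prems obtain k k' where
    k: "int k = int n - 1 - int j - c" "hankel_path n i cs k" and
    k': "int k' = int n - 1 - int j' - c" "hankel_path n i' cs k'"
    by auto
  have "int i - int i' = (- 1) ^ length cs * (int k - int k')"
    using Cons.IH k(2) k'(2) by blast
  also have "int k - int k' = (- 1) * (int j - int j')"
    using k(1) k'(1) by simp
  finally show ?case
    by (simp only: length_Cons power_Suc mult_ac)
qed auto

text \<open>For odd length the difference of two closing start points equals its own negative.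
  Parity is essential: the word \<open>[c, c]\<close> closes at every start point whose intermediate
  index is in range.\<close>

lemma closed_paths_le_1:
  assumes "odd (length cs)"
  shows "closed_paths n cs \<le> 1"
proof -
  have "i = i'" if "hankel_path n i cs i" "hankel_path n i' cs i'" for i i'
    using hankel_path_diff[OF that] assms by simp
  then show ?thesis
    unfolding closed_paths_def by (auto simp: card_le_Suc0_iff_eq)
qed

section \<open>Words without singletons\<close>

lemma card_words: "card (words b k) = (2 * b + 1) ^ k"
proof -
  have "card {- int b..int b} = 2 * b + 1"
    by simp
  then show ?thesis
    by (simp only: card_lists_length_eq finite_atLeastAtMost_int)
qed

lemma finite_words: "finite (words b k)"
  by (rule finite_lists_length_eq) simp

text \<open>Among the words of length \<open>2 * p\<close>, only these can have nonzero expectation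
  in the second moment, since a letter occurring exactly once contributes a mean-zero
  factor.\<close>

definition repeated_words :: "nat \<Rightarrow> nat \<Rightarrow> int list set" where
  "repeated_words b k = {d \<in> words b k. \<forall>v\<in>set d. count_list d v \<ge> 2}"

text \<open>Such a word is determined by a list of \<open>p\<close> values that contains all its letters, together
  with the positions of its letters in that list.\<close>

lemma card_repeated_words_le:
  "card (repeated_words b (2 * p)) \<le> p ^ (2 * p) * (2 * b + 1) ^ p"
proof -
  let ?G = "{g. set g \<subseteq> {..<p} \<and> length g = 2 * p}"
  have fin: "finite ?G"
    by (rule finite_lists_length_eq) simp
  have "repeated_words b (2 * p) \<subseteq> (\<lambda>(g, vs). map ((!) vs) g) ` (?G \<times> words b p)"
  proof
    fix d assume "d \<in> repeated_words b (2 * p)"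
    then have d: "set d \<subseteq> {- int b..int b}" "length d = 2 * p"
      "\<And>v. v \<in> set d \<Longrightarrow> count_list d v \<ge> 2"
      by (auto simp: repeated_words_def)
    have "2 * card (set d) = (\<Sum>v\<in>set d. 2)"
      by simp
    also have "\<dots> \<le> (\<Sum>v\<in>set d. count_list d v)"
      using d(3) by (intro sum_mono) auto
    also have "\<dots> = 2 * p"
      using d(2) sum_count_set[of d "set d"] by simp
    finally have "card (set d) \<le> p"
      by simp
    \<comment> \<open>Padding with 0 gives length exactly \<open>p\<close> and stays inside the
      alphabet, because 0 lies in the band.\<close>
    define vs where "vs = sorted_list_of_set (set d) @ replicate (p - card (set d)) 0"
    have vs: "length vs = p" "set d \<subseteq> set vs" "set vs \<subseteq> {- int b..int b}"
      using \<open>card (set d) \<le> p\<close> d(1) by (auto simp: vs_def)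
    have "\<exists>k<p. vs ! k = v" if "v \<in> set d" for v
      using that vs by (metis in_set_conv_nth subsetD)
    then obtain pos where pos: "pos v < p" "vs ! pos v = v" if "v \<in> set d" for v
      by metis
    have "d = map ((!) vs) (map pos d)"
      by (auto simp: pos intro!: nth_equalityI)
    moreover have "map pos d \<in> ?G"
      using pos d(2) by auto
    ultimately show "d \<in> (\<lambda>(g, vs). map ((!) vs) g) ` (?G \<times> words b p)"
      using vs by (intro image_eqI[where x = "(map pos d, vs)"]) auto
  qed
  then have "card (repeated_words b (2 * p)) \<le> card (?G \<times> words b p)"
    by (rule surj_card_le[rotated]) (use fin finite_words in auto)
  also have "\<dots> = p ^ (2 * p) * (2 * b + 1) ^ p"
    by (simp only: card_cartesian_product card_words) (simp add: card_lists_length_eq)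
  finally show ?thesis .
qed

section \<open>Moments of products\<close>

text \<open>The product is at most the largest absolute value raised to the length, and that power
  is one of the summands. Mixed moments are thus controlled by single-variable moments.\<close>

lemma abs_prod_list_le_sum_list_power:
  fixes ys :: "real list"
  assumes "ys \<noteq> []"
  shows "\<bar>prod_list ys\<bar> \<le> (\<Sum>y\<leftarrow>ys. \<bar>y\<bar> ^ length ys)"
proof -
  define m where "m = Max (abs ` set ys)"
  have m: "\<bar>y\<bar> \<le> m" if "y \<in> set ys" for y
    using that by (auto simp: m_def)
  have "\<bar>prod_list zs\<bar> \<le> m ^ length zs" if "set zs \<subseteq> set ys" for zs
    using that
  proof (induction zs)
    case (Cons z zs)
    then show ?case
      by (auto simp: abs_mult intro!: mult_mono m order_trans[OF abs_ge_zero m])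
  qed simp
  then have "\<bar>prod_list ys\<bar> \<le> m ^ length ys"
    by blast
  also have "m \<in> abs ` set ys"
    unfolding m_def using assms by (intro Max_in) auto
  then have "m ^ length ys \<le> (\<Sum>y\<leftarrow>ys. \<bar>y\<bar> ^ length ys)"
    by (auto intro!: member_le_sum_list)
  finally show ?thesis .
qed

text \<open>Grouping equal letters leaves one factor per distinct variable, the form to which
  independence applies.\<close>

lemma prod_list_map_eq_prod_count:
  "prod_list (map f d) = (\<Prod>v\<in>set d. f v ^ count_list d v)"
  for f :: "'b \<Rightarrow> 'c :: comm_monoid_mult"
proof (induction d)
  case (Cons a d)
  have *: "(\<Prod>v\<in>set d - {a}. f v ^ count_list (a # d) v) = (\<Prod>v\<in>set d - {a}. f v ^ count_list d v)"
    by (intro prod.cong) auto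
  show ?case
  proof (cases "a \<in> set d")
    case True
    then show ?thesis
      using Cons * by (simp add: insert_absorb prod.remove[of "set d" a] mult_ac)
  next
    case False
    then show ?thesis
      using Cons * by (simp add: count_notin)
  qed
qed simp

context prob_space
begin

text \<open>By independence the expectation factors over the distinct letters, and the factor of
  \<open>v\<close> is its first moment, which is 0.\<close>

lemma expectation_prod_list_singleton:
  fixes x :: "'i \<Rightarrow> 'a \<Rightarrow> real"
  assumes indep: "indep_vars (\<lambda>_. borel) x I"
    and d: "set d \<subseteq> I"
    and integ: "\<And>j k. j \<in> I \<Longrightarrow> k \<le> length d \<Longrightarrow> integrable M (\<lambda>\<omega>. x j \<omega> ^ k)"
    and v: "count_list d v = 1" "expectation (x v) = 0"
  shows "expectation (\<lambda>\<omega>. prod_list (map (\<lambda>j. x j \<omega>) d)) = 0"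
proof -
  have "indep_vars (\<lambda>_. borel) x (set d)"
    using indep d by (rule indep_vars_subset)
  then have indep': "indep_vars (\<lambda>_. borel) (\<lambda>j \<omega>. x j \<omega> ^ count_list d j) (set d)"
    by (rule indep_vars_compose2) simp
  have "expectation (\<lambda>\<omega>. prod_list (map (\<lambda>j. x j \<omega>) d)) =
      (\<Prod>j\<in>set d. expectation (\<lambda>\<omega>. x j \<omega> ^ count_list d j))"
    unfolding prod_list_map_eq_prod_count using d
    by (intro indep_vars_lebesgue_integral indep' integ) (auto simp: count_le_length)
  also have "v \<in> set d"
    using v(1) by (metis count_notin zero_neq_one)
  then have "(\<Prod>j\<in>set d. expectation (\<lambda>\<omega>. x j \<omega> ^ count_list d j)) = 0"
    using v by (intro prod_zero) (auto intro!: bexI[of _ v])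
  finally show ?thesis .
qed

lemma integrable_power_le:
  fixes f :: "'a \<Rightarrow> real"
  assumes [measurable]: "random_variable borel f"
    and integ: "integrable M (\<lambda>\<omega>. \<bar>f \<omega>\<bar> ^ m)" and "k \<le> m"
  shows "integrable M (\<lambda>\<omega>. f \<omega> ^ k)"
proof (rule Bochner_Integration.integrable_bound)
  show "integrable M (\<lambda>\<omega>. 1 + \<bar>f \<omega>\<bar> ^ m)"
    using integ by simp
  have "\<bar>y\<bar> ^ k \<le> 1 + \<bar>y\<bar> ^ m" for y :: real
  proof (cases "\<bar>y\<bar> \<le> 1")
    case True
    then have "\<bar>y\<bar> ^ k \<le> 1"
      by (simp add: power_le_one)
    then show ?thesis
      by (intro add_increasing2) auto
  next
    case False
    then have "\<bar>y\<bar> ^ k \<le> \<bar>y\<bar> ^ m"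
      using \<open>k \<le> m\<close> by (intro power_increasing) auto
    then show ?thesis
      by simp
  qed
  then show "AE \<omega> in M. norm (f \<omega> ^ k) \<le> norm (1 + \<bar>f \<omega>\<bar> ^ m)"
    by (auto simp: power_abs)
qed measurable

lemma prod_list_moment_bound:
  fixes x :: "'i \<Rightarrow> 'a \<Rightarrow> real"
  assumes rv: "\<And>j. random_variable borel (x j)"
    and integ: "\<And>j. integrable M (\<lambda>\<omega>. \<bar>x j \<omega>\<bar> ^ length d)"
    and bound: "\<And>j. expectation (\<lambda>\<omega>. \<bar>x j \<omega>\<bar> ^ length d) \<le> K"
    and "d \<noteq> []"
  shows "integrable M (\<lambda>\<omega>. prod_list (map (\<lambda>j. x j \<omega>) d))"
    and "\<bar>expectation (\<lambda>\<omega>. prod_list (map (\<lambda>j. x j \<omega>) d))\<bar> \<le> real (length d) * K"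
proof -
  let ?P = "\<lambda>\<omega>. prod_list (map (\<lambda>j. x j \<omega>) d)"
  let ?S = "\<lambda>\<omega>. \<Sum>j\<leftarrow>d. \<bar>x j \<omega>\<bar> ^ length d"
  have le: "\<bar>?P \<omega>\<bar> \<le> ?S \<omega>" for \<omega>
    using abs_prod_list_le_sum_list_power[of "map (\<lambda>j. x j \<omega>) d"] \<open>d \<noteq> []\<close>
    by (simp add: comp_def)
  \<comment> \<open>The summation list is generalised to \<open>e\<close> so that the induction
    leaves the exponent \<open>length d\<close> fixed.\<close>
  have S: "integrable M (\<lambda>\<omega>. \<Sum>j\<leftarrow>e. \<bar>x j \<omega>\<bar> ^ length d) \<and>
      expectation (\<lambda>\<omega>. \<Sum>j\<leftarrow>e. \<bar>x j \<omega>\<bar> ^ length d) \<le> real (length e) * K" for e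
  proof (induction e)
    case (Cons a e)
    then show ?case
      using integ[of a] bound[of a] by (simp add: algebra_simps)
  qed simp
  have meas: "(\<lambda>\<omega>. prod_list (map (\<lambda>j. x j \<omega>) e)) \<in> borel_measurable M" for e
    using rv by (induction e) auto
  show P: "integrable M ?P"
  proof (rule Bochner_Integration.integrable_bound)
    show "integrable M ?S"
      using S by blast
    show "AE \<omega> in M. norm (?P \<omega>) \<le> norm (?S \<omega>)"
      using le by (intro AE_I2) (metis abs_ge_self order_trans real_norm_def)
  qed (rule meas)
  have "\<bar>expectation ?P\<bar> \<le> expectation (\<lambda>\<omega>. \<bar>?P \<omega>\<bar>)"
    by (rule integral_abs_bound)
  also have "\<dots> \<le> expectation ?S"
    using P S le by (intro integral_mono) auto
  also have "\<dots> \<le> real (length d) * K"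
    using S by blast
  finally show "\<bar>expectation ?P\<bar> \<le> real (length d) * K" .
qed

text \<open>Squaring yields a double sum over pairs of words, that is, over concatenations of length
  \<open>2 * p\<close>. The coefficients are at most 1 in absolute value, only
  \<open>repeated_words\<close> survive, and each of these contributes at most
  \<open>2 * p * K\<close>.\<close>

lemma second_moment_word_sum_le:
  fixes x :: "int \<Rightarrow> 'a \<Rightarrow> real" and a :: "int list \<Rightarrow> real" and b p :: nat and K :: real
  assumes indep: "indep_vars (\<lambda>_. borel) x (UNIV - {0})"
    and x0: "x 0 = (\<lambda>_. 0)"
    and mean: "\<And>j. expectation (x j) = 0"
    and integ: "\<And>j. integrable M (\<lambda>\<omega>. \<bar>x j \<omega>\<bar> ^ (2 * p))"
    and bound: "\<And>j. expectation (\<lambda>\<omega>. \<bar>x j \<omega>\<bar> ^ (2 * p)) \<le> K"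
    and a: "\<And>cs. length cs = p \<Longrightarrow> \<bar>a cs\<bar> \<le> 1"
    and "p > 0"
  defines "Y \<equiv> \<lambda>\<omega>. \<Sum>cs\<in>words b p. a cs * prod_list (map (\<lambda>j. x j \<omega>) cs)"
  shows "random_variable borel Y"
    and "integrable M (\<lambda>\<omega>. (Y \<omega>)\<^sup>2)"
    and "expectation (\<lambda>\<omega>. (Y \<omega>)\<^sup>2) \<le>
      real (p ^ (2 * p) * (2 * b + 1) ^ p) * (real (2 * p) * K)"
proof -
  let ?P = "\<lambda>d \<omega>. prod_list (map (\<lambda>j. x j \<omega>) d)"
  have rv: "random_variable borel (x j)" for j
    using indep x0 by (cases "j = 0") (auto simp: indep_vars_def)
  have P_meas: "random_variable borel (?P d)" for d
    using rv by (induction d) auto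
  show "random_variable borel Y"
    unfolding Y_def using P_meas by simp
  have P_int: "integrable M (?P d)" and P_le: "\<bar>expectation (?P d)\<bar> \<le> real (2 * p) * K"
    if "length d = 2 * p" for d
    using prod_list_moment_bound[of x d K] rv integ bound that \<open>p > 0\<close> by (cases d; simp)+
  have P_0: "expectation (?P d) = 0" if "d \<in> words b (2 * p) - repeated_words b (2 * p)" for d
  \<comment> \<open>\<open>x 0\<close> lies outside the independent family, but it vanishes
    identically and so makes the whole product zero.\<close>
  proof (cases "0 \<in> set d")
    case True
    then have "?P d \<omega> = 0" for \<omega>
      using x0 by (force simp: prod_list_zero_iff image_iff)
    then show ?thesis
      by simp
  next
    case False
    from that obtain v where v: "v \<in> set d" "count_list d v < 2" and len: "length d = 2 * p"
      by (auto simp: repeated_words_def)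
    then have "count_list d v \<noteq> 0"
      by (simp add: count_list_0_iff)
    then have "count_list d v = 1"
      using v by linarith
    then show ?thesis
      using False len mean integrable_power_le[OF rv integ]
      by (intro expectation_prod_list_singleton[OF indep]) auto
  qed
  have sq: "(Y \<omega>)\<^sup>2 = (\<Sum>(cs, cs')\<in>words b p \<times> words b p. a cs * a cs' * ?P (cs @ cs') \<omega>)" for \<omega>
    unfolding Y_def power2_eq_square sum_product
    by (simp add: sum.cartesian_product mult_ac)
  show "integrable M (\<lambda>\<omega>. (Y \<omega>)\<^sup>2)"
    unfolding sq split_def
    by (intro Bochner_Integration.integrable_sum integrable_mult_right P_int) auto
  have "expectation (\<lambda>\<omega>. (Y \<omega>)\<^sup>2) =
      (\<Sum>(cs, cs')\<in>words b p \<times> words b p. a cs * a cs' * expectation (?P (cs @ cs')))"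
    unfolding sq split_def
    by (subst Bochner_Integration.integral_sum)
       (auto intro!: integrable_mult_right P_int sum.cong simp del: map_append)
  also have "\<dots> \<le> (\<Sum>(cs, cs')\<in>words b p \<times> words b p. \<bar>expectation (?P (cs @ cs'))\<bar>)"
  proof (rule sum_mono)
    fix z assume "z \<in> words b p \<times> words b p"
    then obtain cs cs' where z: "z = (cs, cs')" and "length cs = p" "length cs' = p"
      by auto
    then have "\<bar>a cs * a cs'\<bar> \<le> 1"
      using a by (simp add: abs_mult mult_le_one)
    then have "\<bar>a cs * a cs'\<bar> * \<bar>expectation (?P (cs @ cs'))\<bar> \<le> \<bar>expectation (?P (cs @ cs'))\<bar>"
      by (intro mult_left_le_one_le) auto
    then have "a cs * a cs' * expectation (?P (cs @ cs')) \<le> \<bar>expectation (?P (cs @ cs'))\<bar>"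
      unfolding abs_mult [symmetric] by (rule order_trans[OF abs_ge_self])
    then show "(case z of (cs, cs') \<Rightarrow> a cs * a cs' * expectation (?P (cs @ cs'))) \<le>
        (case z of (cs, cs') \<Rightarrow> \<bar>expectation (?P (cs @ cs'))\<bar>)"
      by (simp only: z split)
  qed
  \<comment> \<open>Concatenation is injective here because both halves have the fixed length
    \<open>p\<close>.\<close>
  also have "\<dots> = (\<Sum>d\<in>(\<lambda>(cs, cs'). cs @ cs') ` (words b p \<times> words b p). \<bar>expectation (?P d)\<bar>)"
  proof -
    have "inj_on (\<lambda>(cs, cs'). cs @ cs') (words b p \<times> words b p)"
      unfolding inj_on_def by (clarsimp simp del: atLeastAtMost_iff)
    then show ?thesis
      by (subst sum.reindex) (simp_all only: comp_def split_def)
  qed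
  also have "\<dots> \<le> (\<Sum>d\<in>words b (2 * p). \<bar>expectation (?P d)\<bar>)"
    by (intro sum_mono2 finite_words) (auto simp del: atLeastAtMost_iff)
  also have "\<dots> = (\<Sum>d\<in>repeated_words b (2 * p). \<bar>expectation (?P d)\<bar>)"
    using P_0 by (intro sum.mono_neutral_right finite_words) (auto simp: repeated_words_def)
  also have "\<dots> \<le> real (card (repeated_words b (2 * p))) * (real (2 * p) * K)"
    by (rule sum_bounded_above, rule P_le) (auto simp: repeated_words_def)
  also have "\<dots> \<le> real (p ^ (2 * p) * (2 * b + 1) ^ p) * (real (2 * p) * K)"
  proof (rule mult_right_mono)
    show "real (card (repeated_words b (2 * p))) \<le> real (p ^ (2 * p) * (2 * b + 1) ^ p)"
      by (rule of_nat_mono) (rule card_repeated_words_le)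
    \<comment> \<open>The sign of \<open>K\<close> is not assumed; it follows because
      \<open>K\<close> bounds a nonnegative moment.\<close>
    have "0 \<le> expectation (\<lambda>\<omega>. \<bar>x 0 \<omega>\<bar> ^ (2 * p))"
      by (rule Bochner_Integration.integral_nonneg) simp
    then have "0 \<le> K"
      by (rule order_trans) (rule bound)
    then show "0 \<le> real (2 * p) * K"
      by simp
  qed
  finally show "expectation (\<lambda>\<omega>. (Y \<omega>)\<^sup>2) \<le>
      real (p ^ (2 * p) * (2 * b + 1) ^ p) * (real (2 * p) * K)" .
qed

section \<open>Convergence in distribution to 0 from vanishing second moments\<close>

lemma weak_conv_m_return_0I:
  fixes X :: "nat \<Rightarrow> 'a \<Rightarrow> real"
  assumes [measurable]: "\<And>n. random_variable borel (X n)"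
    and integ: "\<And>n. integrable M (\<lambda>\<omega>. (X n \<omega>)\<^sup>2)"
    and lim: "(\<lambda>n. expectation (\<lambda>\<omega>. (X n \<omega>)\<^sup>2)) \<longlonglongrightarrow> 0"
  shows "weak_conv_m (\<lambda>n. distr M borel (X n)) (return borel 0)"
proof -
  have cdf_X: "cdf (distr M borel (X n)) y = prob {\<omega>\<in>space M. X n \<omega> \<le> y}" for n y
    by (auto simp: cdf_def measure_distr vimage_def Int_def conj_commute)
  have cdf_0: "cdf (return borel 0) y = (if 0 \<le> y then 1 else 0)" for y :: real
    by (simp add: cdf_def measure_return)
  \<comment> \<open>Chebyshev's inequality gives convergence in probability.\<close>
  have tail: "(\<lambda>n. prob {\<omega>\<in>space M. \<bar>X n \<omega>\<bar> \<ge> \<epsilon>}) \<longlonglongrightarrow> 0" if "\<epsilon> > 0" for \<epsilon>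
  proof (rule tendsto_sandwich[OF _ _ tendsto_const])
    show "(\<lambda>n. expectation (\<lambda>\<omega>. (X n \<omega>)\<^sup>2) / \<epsilon>\<^sup>2) \<longlonglongrightarrow> 0"
      using tendsto_divide[OF lim tendsto_const[of "\<epsilon>\<^sup>2"]] that by simp
    have "prob {\<omega>\<in>space M. \<bar>X n \<omega>\<bar> \<ge> \<epsilon>} \<le> expectation (\<lambda>\<omega>. (X n \<omega>)\<^sup>2) / \<epsilon>\<^sup>2" for n
      using that by (intro second_moment_method integ) auto
    then show "\<forall>\<^sub>F n in sequentially.
        prob {\<omega>\<in>space M. \<bar>X n \<omega>\<bar> \<ge> \<epsilon>} \<le> expectation (\<lambda>\<omega>. (X n \<omega>)\<^sup>2) / \<epsilon>\<^sup>2"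
      by simp
  qed simp
  have "(\<lambda>n. cdf (distr M borel (X n)) y) \<longlonglongrightarrow> cdf (return borel 0) y"
    if cont: "isCont (cdf (return borel (0::real))) y" for y
  proof -
    consider "y > 0" | "y < 0" | "y = 0"
      by linarith
    then show ?thesis
    proof cases
      case 1
      have "1 - prob {\<omega>\<in>space M. \<bar>X n \<omega>\<bar> \<ge> y} \<le> prob {\<omega>\<in>space M. X n \<omega> \<le> y}" for n
      proof -
        have "1 - prob {\<omega>\<in>space M. \<bar>X n \<omega>\<bar> \<ge> y} = prob {\<omega>\<in>space M. \<not> \<bar>X n \<omega>\<bar> \<ge> y}"
          by (subst prob_neg) auto
        also have "\<dots> \<le> prob {\<omega>\<in>space M. X n \<omega> \<le> y}"
          by (intro finite_measure_mono) auto
        finally show ?thesis .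
      qed
      note le = this
      have "(\<lambda>n. 1 - prob {\<omega>\<in>space M. \<bar>X n \<omega>\<bar> \<ge> y}) \<longlonglongrightarrow> 1"
        using tendsto_diff[OF tendsto_const[of 1] tail[OF 1]] by simp
      then have "(\<lambda>n. prob {\<omega>\<in>space M. X n \<omega> \<le> y}) \<longlonglongrightarrow> 1"
        by (rule tendsto_sandwich[OF always_eventually always_eventually _ tendsto_const, rotated 2])
          (use le in auto)
      then show ?thesis
        using 1 by (simp add: cdf_X cdf_0)
    next
      case 2
      have "prob {\<omega>\<in>space M. X n \<omega> \<le> y} \<le> prob {\<omega>\<in>space M. \<bar>X n \<omega>\<bar> \<ge> - y}" for n
        by (intro finite_measure_mono) auto
      then have "(\<lambda>n. prob {\<omega>\<in>space M. X n \<omega> \<le> y}) \<longlonglongrightarrow> 0"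
        by (intro tendsto_sandwich[OF always_eventually always_eventually tendsto_const tail[of "- y"]])
          (use 2 in auto)
      then show ?thesis
        using 2 by (simp add: cdf_X cdf_0)
    next
      case 3
      \<comment> \<open>The limiting distribution function jumps at 0, so 0 is not a continuity
        point: continuity would force the left limit to be both 1 and 0.\<close>
      have "(cdf (return borel (0::real)) \<longlongrightarrow> 1) (at_left 0)"
        using cont 3 by (auto simp: isCont_def cdf_0 filterlim_at_split)
      moreover have "(cdf (return borel (0::real)) \<longlongrightarrow> 0) (at_left 0)"
        by (rule tendsto_eventually) (auto simp: cdf_0 eventually_at_filter)
      ultimately show ?thesis
        using tendsto_unique[OF trivial_limit_at_left_real] by fastforce
    qed
  qed
  then show ?thesis
    by (simp add: weak_conv_m_def weak_conv_def)
qed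

end

theorem theorem3:
  fixes M :: "'a measure"
    and x :: "int \<Rightarrow> 'a \<Rightarrow> real"
    and b :: "nat \<Rightarrow> nat"
    and \<beta> \<kappa> :: real
    and \<alpha> :: "nat \<Rightarrow> real"
    and p :: nat
  assumes "prob_space M"
    and "\<And>n. n \<ge> 1 \<Longrightarrow> b n > 0"
    and "filterlim b at_top sequentially"
    and "\<beta> \<in> {0..1}"
    and "(\<lambda>n. real (b n) / real n) \<longlonglongrightarrow> \<beta>"
    and "prob_space.indep_vars M (\<lambda>_. borel) x (UNIV - {0})"
    and "x 0 = (\<lambda>_. 0)"
    and "\<And>j. j \<noteq> 0 \<Longrightarrow> integrable M (x j) \<and> (\<integral>\<omega>. x j \<omega> \<partial>M) = 0"
    and "\<And>j. j \<noteq> 0 \<Longrightarrow> integrable M (\<lambda>\<omega>. x j \<omega> ^ 2) \<and> (\<integral>\<omega>. x j \<omega> ^ 2 \<partial>M) = 1"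
    and "\<And>j. j \<noteq> 0 \<Longrightarrow> integrable M (\<lambda>\<omega>. x j \<omega> ^ 4) \<and> (\<integral>\<omega>. x j \<omega> ^ 4 \<partial>M) = \<kappa>"
    and "\<And>k. k \<ge> 3 \<Longrightarrow>
           (SUP j\<in>UNIV - {0}. \<integral>\<^sup>+ \<omega>. ennreal (\<bar>x j \<omega>\<bar> ^ k) \<partial>M) = ennreal (\<alpha> k)"
    and "odd p"
  shows "weak_conv_m (\<lambda>n. distr M borel (trace_fluctuation M x n (b n) p)) (return borel 0)"
proof -
  interpret prob_space M by fact
  define Y where "Y n \<omega> = (\<Sum>cs\<in>words (b n) p.
    real (closed_paths n cs) * prod_list (map (\<lambda>j. x j \<omega>) cs))" for n \<omega>
  have "p > 0"
    using \<open>odd p\<close> by (rule odd_pos)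
  have rv: "random_variable borel (x j)" for j
    using assms(6,7) by (cases "j = 0") (auto simp: indep_vars_def)
  have mean: "expectation (x j) = 0" for j
    using assms(7,8) by (cases "j = 0") auto
  obtain K where K: "\<And>j. integrable M (\<lambda>\<omega>. \<bar>x j \<omega>\<bar> ^ (2 * p))"
    "\<And>j. expectation (\<lambda>\<omega>. \<bar>x j \<omega>\<bar> ^ (2 * p)) \<le> K"
  \<comment> \<open>The uniform moment bounds start at exponent 3, so \<open>p = 1\<close> relies on
    the unit second moments instead.\<close>
  proof (cases "p = 1")
    case True
    have "integrable M (\<lambda>\<omega>. \<bar>x j \<omega>\<bar> ^ (2 * p)) \<and> expectation (\<lambda>\<omega>. \<bar>x j \<omega>\<bar> ^ (2 * p)) \<le> 1" for j
      using assms(7,9) True by (cases "j = 0") auto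
    then show ?thesis
      using that by blast
  next
    case False
    then have "2 * p \<ge> 3"
      using \<open>p > 0\<close> by simp
    have le: "(\<integral>\<^sup>+ \<omega>. ennreal (\<bar>x j \<omega>\<bar> ^ (2 * p)) \<partial>M) \<le> ennreal (\<alpha> (2 * p))" for j
    proof (cases "j = 0")
      case True
      then show ?thesis
        using assms(7) \<open>p > 0\<close> by (simp add: power_0_left)
    next
      case False
      then show ?thesis
        using assms(11)[OF \<open>2 * p \<ge> 3\<close>] by (metis (no_types, lifting) DiffI SUP_upper UNIV_I singletonD)
    qed
    have int: "integrable M (\<lambda>\<omega>. \<bar>x j \<omega>\<bar> ^ (2 * p))" for j
      using le[of j] rv[of j]
      by (intro integrableI_nonneg) (auto intro: order.strict_trans1)
    \<comment> \<open>\<open>ennreal\<close> sends negative reals to 0, so the real bound extracted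
      from it is the maximum with 0.\<close>
    have "expectation (\<lambda>\<omega>. \<bar>x j \<omega>\<bar> ^ (2 * p)) \<le> max 0 (\<alpha> (2 * p))" for j
    proof -
      have "ennreal (expectation (\<lambda>\<omega>. \<bar>x j \<omega>\<bar> ^ (2 * p))) \<le> ennreal (max 0 (\<alpha> (2 * p)))"
        using le[of j] int[of j] by (subst nn_integral_eq_integral [symmetric]) (auto simp: ennreal_max_0)
      then show ?thesis
        by (metis ennreal_le_iff max.cobounded1)
    qed
    with int show ?thesis
      using that by blast
  qed
  have coeff: "\<bar>real (closed_paths n cs)\<bar> \<le> 1" if "length cs = p" for n cs
    using closed_paths_le_1[of cs n] that \<open>odd p\<close> by simp
  have moment: "random_variable borel (Y n)" "integrable M (\<lambda>\<omega>. (Y n \<omega>)\<^sup>2)"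
    "expectation (\<lambda>\<omega>. (Y n \<omega>)\<^sup>2) \<le>
      real (p ^ (2 * p) * (2 * b n + 1) ^ p) * (real (2 * p) * K)" for n
    using second_moment_word_sum_le[where a = "\<lambda>cs. real (closed_paths n cs)" and b = "b n",
        OF assms(6,7) mean K coeff \<open>p > 0\<close>]
    unfolding Y_def by blast+
  note [measurable] = moment(1)
  have Y_int: "integrable M (Y n)" for n
    by (rule square_integrable_imp_integrable[OF moment(1) moment(2)])
  \<comment> \<open>For \<open>b n > 0\<close>, the square of this factor is
    \<open>b n / n^2\<close> divided by \<open>b n ^ p\<close>; the last power cancels the growth of
    the second moment of \<open>Y n\<close>.\<close>
  define c where "c n = sqrt (real (b n)) / real n * (1 / sqrt (real (b n))) ^ p" for n
  have w: "trace_fluctuation M x n (b n) p = (\<lambda>\<omega>. c n * (Y n \<omega> - expectation (Y n)))" for n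
    unfolding trace_fluctuation_def mat_trace_scaled_band_hankel_pow Y_def [symmetric] c_def
    by (auto simp: algebra_simps diff_divide_distrib)
  \<comment> \<open>The factor \<open>3 ^ p\<close> comes from
    \<open>2 * b n + 1 \<le> 3 * b n\<close>, valid once \<open>b n \<ge> 1\<close>.\<close>
  define C where "C = real (p ^ (2 * p) * 3 ^ p) * (real (2 * p) * K)"
  have "0 \<le> expectation (\<lambda>\<omega>. \<bar>x 0 \<omega>\<bar> ^ (2 * p))"
    by simp
  then have "K \<ge> 0"
    using K(2)[of 0] by linarith
  have bound: "expectation (\<lambda>\<omega>. (trace_fluctuation M x n (b n) p \<omega>)\<^sup>2) \<le>
      C * (real (b n) / real n * (1 / real n))" if "n \<ge> 1" for n
  proof -
    have "b n \<ge> 1"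
      using assms(2)[OF that] by simp
    have "variance (Y n) \<le> expectation (\<lambda>\<omega>. (Y n \<omega>)\<^sup>2)"
      using variance_eq[OF Y_int moment(2)] by simp
    also have "\<dots> \<le> real (p ^ (2 * p) * (2 * b n + 1) ^ p) * (real (2 * p) * K)"
      by (rule moment(3))
    also have "\<dots> \<le> real (p ^ (2 * p) * (3 * b n) ^ p) * (real (2 * p) * K)"
      using \<open>K \<ge> 0\<close> \<open>b n \<ge> 1\<close>
      by (intro mult_right_mono of_nat_mono mult_left_mono power_mono) auto
    also have "\<dots> = C * real (b n) ^ p"
      by (simp add: C_def power_mult_distrib)
    finally have var: "variance (Y n) \<le> C * real (b n) ^ p" .
    have "expectation (\<lambda>\<omega>. (trace_fluctuation M x n (b n) p \<omega>)\<^sup>2) = (c n)\<^sup>2 * variance (Y n)"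
      unfolding w by (simp add: power_mult_distrib)
    also have "\<dots> \<le> (c n)\<^sup>2 * (C * real (b n) ^ p)"
      using var by (intro mult_left_mono) auto
    also have "(c n)\<^sup>2 * (C * real (b n) ^ p) = C * (real (b n) / real n * (1 / real n))"
    proof -
      have sq: "((1 / sqrt (real (b n))) ^ p)\<^sup>2 = 1 / real (b n) ^ p"
        by (simp add: power_divide power_mult [symmetric] mult.commute[of p 2])
           (simp add: power_mult)
      have "(c n)\<^sup>2 = real (b n) / (real n)\<^sup>2 * (1 / real (b n) ^ p)"
        unfolding c_def power_mult_distrib sq by (simp add: power_divide)
      then show ?thesis
        using \<open>b n \<ge> 1\<close> by (simp add: power2_eq_square)
    qed
    finally show ?thesis .
  qed
  show ?thesis
  proof (rule weak_conv_m_return_0I)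
    show "random_variable borel (trace_fluctuation M x n (b n) p)" for n
      unfolding w by measurable
    show "integrable M (\<lambda>\<omega>. (trace_fluctuation M x n (b n) p \<omega>)\<^sup>2)" for n
      unfolding w power_mult_distrib power2_diff
      using Y_int moment(2) by (intro integrable_mult_right) auto
    \<comment> \<open>The ratio \<open>b n / n\<close> tends to the finite limit \<beta>, and the
      remaining factor \<open>1 / n\<close> tends to 0.\<close>
    have lim: "(\<lambda>n. C * (real (b n) / real n * (1 / real n))) \<longlonglongrightarrow> 0"
      using tendsto_mult[OF tendsto_const[of C] tendsto_mult[OF assms(5) lim_1_over_n]] by simp
    show "(\<lambda>n. expectation (\<lambda>\<omega>. (trace_fluctuation M x n (b n) p \<omega>)\<^sup>2)) \<longlonglongrightarrow> 0"
      by (rule tendsto_sandwich[OF always_eventually eventually_sequentiallyI[of 1] tendsto_const lim])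
         (use bound in simp_all)
  qed
qed

end
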